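(* Let $\alpha,\beta\in\mathbb{R}\setminus\mathbb{Q}$. Assume that $\alpha$ is not a Liouville number and $\beta$ is a Liouville number. Then any $\alpha\beta$ orbit $(x_n)_{n\geq 0}$ satisfies $\overline{\dim}_B(\{x_n:n\geq 0\})=1$.
   Context: $\mathbb{T}:=\mathbb{R}/\mathbb{Z}$ is the unit circle, with the distance between two points given by $\|x-y\|$, where $\|\cdot\|$ is the distance to the nearest integer. For $\alpha,\beta\in\mathbb{R}\setminus\mathbb{Q}$, a sequence $(x_n)_{n\geq 0}$ of points in $\mathbb{T}$ is called an $\alpha\beta$ orbit if for every $n\geq 0$ either $x_{n+1}-x_n=\alpha \bmod 1$ or $x_{n+1}-x_n=\beta \bmod 1$. For real $\tau\geq 2$, $W(\tau)$ denotes the set of $x\in\mathbb{R}\setminus\mathbb{Q}$ for which there exist infinitely many $(p,q)\in\mathbb{Z}\times\mathbb{N}$ (with $q\geq 1$) satisfying $\left|x-\frac{p}{q}\right|<\frac{1}{q^{\tau}}$. For $x\in\mathbb{R}\setminus\mathbb{Q}$ the exact order of $x$ is $\tau(x):=\sup\{\tau\geq 2: x\in W(\tau)\}\in[2,\infty]$. An irrational $x$ is called a Liouville number if $\tau(x)=\infty$. For a bounded set $F$, $N(F,r)$ denotes the minimum number of closed balls of radius $r$ required to cover $F$, and the upper box dimension is $\overline{\dim}_B(F):=\limsup_{r\to 0}\frac{\log N(F,r)}{-\log r}$. *)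

theory Defs
  imports "HOL-Analysis.Analysis"
begin

section \<open>The circle \<open>\<real>/\<int>\<close> with its quotient metric\<close>

quotient_type circle = real / "\<lambda>x y :: real. x - y \<in> \<int>"
  morphisms rep_circle circle_of
proof (rule equivpI)
  show "reflp (\<lambda>x y :: real. x - y \<in> \<int>)"
    by (simp add: reflp_def)
  show "symp (\<lambda>x y :: real. x - y \<in> \<int>)"
    by (metis (mono_tags, lifting) Ints_minus minus_diff_eq sympI)
  show "transp (\<lambda>x y :: real. x - y \<in> \<int>)"
  proof (rule transpI)
    fix x y z :: real
    assume "x - y \<in> \<int>" "y - z \<in> \<int>"
    then have "(x - y) + (y - z) \<in> \<int>" by (rule Ints_add)
    then show "x - z \<in> \<int>" by simp
  qed
qed

instantiation circle :: ab_group_add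
begin

lift_definition zero_circle :: circle is "0 :: real" .

lift_definition plus_circle :: "circle \<Rightarrow> circle \<Rightarrow> circle" is "(+)"
  by (metis Ints_add add_diff_add)

lift_definition uminus_circle :: "circle \<Rightarrow> circle" is "uminus :: real \<Rightarrow> real"
  by (metis Ints_minus minus_diff_minus)

lift_definition minus_circle :: "circle \<Rightarrow> circle \<Rightarrow> circle" is "(-)"
proof -
  fix a b c d :: real
  assume "a - b \<in> \<int>" "c - d \<in> \<int>"
  then have "(a - b) - (c - d) \<in> \<int>" by (rule Ints_diff)
  then show "a - c - (b - d) \<in> \<int>" by (simp add: algebra_simps)
qed

instance by standard (transfer; simp)+

end

definition dist_nearest_int :: "real \<Rightarrow> real" where
  "dist_nearest_int x = \<bar>x - of_int (round x)\<bar>"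

lemma dist_nearest_int_le: "dist_nearest_int x \<le> \<bar>x - of_int m\<bar>"
  unfolding dist_nearest_int_def by (rule round_diff_minimal)

lemma dist_nearest_int_cong:
  assumes "x - y \<in> \<int>"
  shows "dist_nearest_int x = dist_nearest_int y"
proof -
  obtain k where "x = y + of_int k"
    using assms by (metis Ints_cases add.commute diff_add_cancel)
  then show ?thesis
    using dist_nearest_int_le[of x "round y + k"] dist_nearest_int_le[of y "round x - k"]
    by (simp add: dist_nearest_int_def)
qed

lemma dist_nearest_int_eq_0_iff: "dist_nearest_int x = 0 \<longleftrightarrow> x \<in> \<int>"
proof
  assume "dist_nearest_int x = 0"
  then have "x = of_int (round x)"
    by (simp add: dist_nearest_int_def)
  then show "x \<in> \<int>"
    by (metis Ints_of_int)
qed (auto simp: dist_nearest_int_def elim: Ints_cases)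

lemma dist_nearest_int_minus: "dist_nearest_int (x - y) = dist_nearest_int (y - x)"
  using dist_nearest_int_le[of "x - y" "- round (y - x)"]
    dist_nearest_int_le[of "y - x" "- round (x - y)"]
  by (simp add: dist_nearest_int_def)

lemma dist_nearest_int_add: "dist_nearest_int (x + y) \<le> dist_nearest_int x + dist_nearest_int y"
  using dist_nearest_int_le[of "x + y" "round x + round y"]
  by (simp add: dist_nearest_int_def)

instantiation circle :: metric_space
begin

lift_definition dist_circle :: "circle \<Rightarrow> circle \<Rightarrow> real"
  is "\<lambda>x y. dist_nearest_int (x - y)"
proof -
  fix a b c d :: real
  assume "a - b \<in> \<int>" "c - d \<in> \<int>"
  then have "(a - b) - (c - d) \<in> \<int>" by (rule Ints_diff)
  then show "dist_nearest_int (a - c) = dist_nearest_int (b - d)"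
    by (intro dist_nearest_int_cong) (simp add: algebra_simps)
qed

definition uniformity_circle :: "(circle \<times> circle) filter" where
  "uniformity_circle = (INF e\<in>{0<..}. principal {(x, y). dist x y < e})"

definition open_circle :: "circle set \<Rightarrow> bool" where
  "open_circle U \<longleftrightarrow> (\<forall>x\<in>U. eventually (\<lambda>(x', y). x' = x \<longrightarrow> y \<in> U) uniformity)"

instance
proof
  fix x y z :: circle
  show "dist x y = 0 \<longleftrightarrow> x = y"
    by transfer (rule dist_nearest_int_eq_0_iff)
  show "dist x y \<le> dist x z + dist y z"
  proof transfer
    fix x y z :: real
    have "dist_nearest_int (x - y) \<le> dist_nearest_int (x - z) + dist_nearest_int (z - y)"
      using dist_nearest_int_add[of "x - z" "z - y"] by simp
    then show "dist_nearest_int (x - y) \<le> dist_nearest_int (x - z) + dist_nearest_int (y - z)"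
      by (simp add: dist_nearest_int_minus[of z y])
  qed
qed (simp_all add: uniformity_circle_def open_circle_def)

end

definition alpha_beta_orbit :: "real \<Rightarrow> real \<Rightarrow> (nat \<Rightarrow> circle) \<Rightarrow> bool" where
  "alpha_beta_orbit \<alpha> \<beta> x \<longleftrightarrow>
     (\<forall>n. x (Suc n) - x n = circle_of \<alpha> \<or> x (Suc n) - x n = circle_of \<beta>)"


section \<open>Exact order of irrational numbers\<close>

definition W :: "real \<Rightarrow> real set" where
  "W \<tau> = {x. x \<notin> \<rat> \<and>
     infinite {(p :: int, q :: nat). q \<ge> 1 \<and>
       \<bar>x - of_int p / of_nat q\<bar> < 1 / (of_nat q powr \<tau>)}}"

definition exact_order :: "real \<Rightarrow> ereal" where
  "exact_order x = Sup (ereal ` {\<tau>. \<tau> \<ge> 2 \<and> x \<in> W \<tau>})"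

definition liouville_number :: "real \<Rightarrow> bool" where
  "liouville_number x \<longleftrightarrow> x \<notin> \<rat> \<and> exact_order x = \<infinity>"


section \<open>Upper box dimension\<close>

text \<open>
  Balls are counted by their centres, which range over the whole space. The value is only
  meaningful if some finite cover exists; in the circle this holds for every
  \<open>r > 0\<close> by the lemma below.
\<close>

definition covering_number :: "'a::metric_space set \<Rightarrow> real \<Rightarrow> nat" where
  "covering_number F r = (LEAST n. \<exists>C. finite C \<and> card C = n \<and> F \<subseteq> (\<Union>c\<in>C. cball c r))"

definition upper_box_dim :: "'a::metric_space set \<Rightarrow> ereal" where
  "upper_box_dim F =
     Limsup (at_right 0) (\<lambda>r. ereal (ln (real (covering_number F r)) / - ln r))"

lemma circle_finite_cover:
  fixes F :: "circle set"
  assumes "r > 0"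
  shows "\<exists>C. finite C \<and> F \<subseteq> (\<Union>c\<in>C. cball c r)"
proof -
  obtain K where K: "finite K" "{0..1} \<subseteq> (\<Union>t\<in>K. ball (t :: real) r)"
    using compact_eq_totally_bounded[of "{0..1 :: real}"] assms by (metis compact_Icc)
  have "F \<subseteq> (\<Union>c\<in>circle_of ` K. cball c r)"
  proof
    fix z :: circle
    obtain s where s: "z = circle_of s"
      by (metis Quotient_abs_rep[OF Quotient_circle])
    have z: "z = circle_of (frac s)"
      unfolding s by (simp add: circle.abs_eq_iff frac_def)
    have "frac s \<in> {0..1}"
      using frac_lt_1[of s] by simp
    then obtain t where t: "t \<in> K" "dist t (frac s) < r"
      using K(2) by (metis UN_E mem_ball subsetD)
    have "dist (circle_of t) z \<le> r"
      using dist_nearest_int_le[of "t - frac s" 0] t(2)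
      unfolding z by (simp add: dist_circle.abs_eq dist_real_def)
    then show "z \<in> (\<Union>c\<in>circle_of ` K. cball c r)"
      using t(1) by auto
  qed
  with K(1) show ?thesis by blast
qed

end

theory Submission
  imports Defs
begin

text \<open>
  Write \<open>\<parallel>t\<parallel>\<close> for the distance from \<open>t\<close> to the nearest integer and \<open>N(F, r)\<close> for the covering
  number. Since \<open>N(F, r)\<close> is at most about \<open>1/r\<close> on the circle, only the lower bound matters, and
  since the dimension is an upper limit, it is enough to exhibit good scales \<open>r\<close> tending to \<open>0\<close>.

  A useful way to see many points at a small scale is to multiply by an integer \<open>q\<close>: if \<open>q F\<close> comes
  within \<open>1/(4m)\<close> of every point of the circle, then \<open>N(F, 1/(5mq)) \<ge> m\<close>. When \<open>m\<close> is
  large and at least \<open>q ^ L\<close>, this gives a ratio \<open>ln N / - ln r\<close> that tends to \<open>1\<close> as \<open>L\<close> grows. This is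
  \<open>upper_box_dim_ge_of_dilate_dense\<close>. Pairs \<open>(m, q)\<close> are found according to how often the orbit
  moves by \<open>\<alpha>\<close>.

  If there are arbitrarily long runs of consecutive \<open>\<beta>\<close> steps, the orbit contains arbitrarily long
  pieces of an irrational rotation, hence is dense, and \<open>q = 1\<close> works with every \<open>m\<close>
  (\<open>dilate_dense_of_long_runs\<close>).

  Otherwise there is \<open>H\<close> such that among any \<open>H\<close> consecutive steps one is an \<open>\<alpha>\<close> step
  (\<open>dilate_dense_of_bounded_gaps\<close>). Because \<open>\<beta>\<close> is a Liouville number, \<open>\<parallel>q \<beta>\<parallel>\<close> is smaller than
  any prescribed power of \<open>1/q\<close> for suitable large \<open>q\<close>. Multiplied by \<open>q\<close>, the \<open>\<beta>\<close> steps
  therefore hardly move for a time that is polynomial in \<open>q\<close> of any chosen degree, and during this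
  time \<open>q x\<^sub>n\<close> follows the rotation by \<open>q \<alpha>\<close>. By Dirichlet's theorem some multiple \<open>Q q \<alpha>\<close> with
  \<open>Q \<le> 8m\<close> has \<open>\<parallel>Q q \<alpha>\<parallel> < 1/(8m)\<close>, and its multiples go round the circle in about
  \<open>1 / \<parallel>Q q \<alpha>\<parallel>\<close> steps. As \<open>\<alpha>\<close> is not a Liouville number, \<open>\<parallel>Q q \<alpha>\<parallel>\<close> is bounded below by a
  power of \<open>1/(Q q)\<close>, so for \<open>m = q ^ L\<close> the round trip takes only polynomial time, which the
  approximation quality of \<open>\<beta>\<close> can be chosen to outlast.
\<close>

section \<open>The distance to the nearest integer\<close>

lemma dist_nearest_int_nonneg: "0 \<le> dist_nearest_int x"
  by (simp add: dist_nearest_int_def)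

lemma dist_nearest_int_uminus: "dist_nearest_int (- x) = dist_nearest_int x"
  using dist_nearest_int_minus[of 0 x] by simp

lemma dist_nearest_int_of_nat_mult: "dist_nearest_int (of_nat k * x) \<le> of_nat k * dist_nearest_int x"
  using dist_nearest_int_le[of "of_nat k * x" "of_nat k * round x"]
  by (simp add: dist_nearest_int_def abs_mult flip: right_diff_distrib)

lemma of_nat_mult_not_Rats:
  fixes \<theta> :: real
  assumes "\<theta> \<notin> \<rat>" "k \<ge> 1"
  shows "of_nat k * \<theta> \<notin> \<rat>"
proof
  assume "of_nat k * \<theta> \<in> \<rat>"
  then have "of_nat k * \<theta> / of_nat k \<in> \<rat>"
    by (intro Rats_divide) auto
  then show False
    using assms by simp
qed

lemma dist_nearest_int_pos_of_nat_mult: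
  assumes "\<theta> \<notin> \<rat>" "k \<ge> 1"
  shows "0 < dist_nearest_int (of_nat k * \<theta>)"
proof -
  have "of_nat k * \<theta> \<notin> \<int>"
    using of_nat_mult_not_Rats[OF assms] Ints_subset_Rats by blast
  then show ?thesis
    using dist_nearest_int_eq_0_iff dist_nearest_int_nonneg by (metis less_eq_real_def)
qed

text \<open>
  Stepping round the circle with stride \<open>\<parallel>\<theta>\<parallel>\<close>, one passes within one stride of every point
  before completing the first turn. If the nearest integer to \<open>\<theta>\<close> lies above it, the walk goes
  backwards; reflecting the circle reduces this to the forward case.
\<close>

lemma multiples_dense:
  assumes "0 < dist_nearest_int \<theta>"
  shows "\<exists>j::nat. of_nat j \<le> 1 / dist_nearest_int \<theta> \<and>
           dist_nearest_int (of_nat j * \<theta> - t) \<le> dist_nearest_int \<theta>"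
proof -
  define d where "d = \<theta> - of_int (round \<theta>)"
  \<comment> \<open>The sign \<open>\<epsilon>\<close> turns both \<open>d\<close> and the target round, so that the walk advances by \<open>\<bar>d\<bar>\<close>.\<close>
  define \<epsilon> where "\<epsilon> = sgn d"
  define u where "u = frac (\<epsilon> * t)"
  define j where "j = nat \<lfloor>u / \<bar>d\<bar>\<rfloor>"
  have d: "\<bar>d\<bar> = dist_nearest_int \<theta>" "\<bar>d\<bar> > 0"
    using assms by (auto simp: d_def dist_nearest_int_def)
  have u: "0 \<le> u" "u < 1"
    by (auto simp: u_def frac_lt_1)
  have \<epsilon>: "\<epsilon> = 1 \<or> \<epsilon> = -1"
    using d(2) by (auto simp: \<epsilon>_def sgn_if)
  have j_le: "of_nat j \<le> u / \<bar>d\<bar>" and j_ge: "u / \<bar>d\<bar> < of_nat j + 1"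
    using u d(2) unfolding j_def by (simp_all add: of_nat_nat)
  have "of_nat j * \<bar>d\<bar> \<le> u" "u < of_nat j * \<bar>d\<bar> + \<bar>d\<bar>"
    using j_le j_ge d(2) by (simp_all add: field_simps)
  then have close: "\<bar>of_nat j * \<bar>d\<bar> - u\<bar> \<le> \<bar>d\<bar>"
    by linarith
  have "dist_nearest_int (of_nat j * \<theta> - t) = dist_nearest_int (of_nat j * d - t)"
  proof (rule dist_nearest_int_cong)
    have "of_nat j * \<theta> - t - (of_nat j * d - t) = of_int (of_nat j * round \<theta>)"
      by (simp add: d_def algebra_simps)
    then show "of_nat j * \<theta> - t - (of_nat j * d - t) \<in> \<int>"
      by (metis Ints_of_int)
  qed
  also have "\<dots> = dist_nearest_int (\<epsilon> * (of_nat j * d - t))"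
    using \<epsilon> dist_nearest_int_uminus[of "of_nat j * d - t"] by auto
  also have "\<epsilon> * (of_nat j * d - t) = of_nat j * \<bar>d\<bar> - \<epsilon> * t"
    by (simp add: \<epsilon>_def abs_sgn algebra_simps)
  also have "dist_nearest_int (of_nat j * \<bar>d\<bar> - \<epsilon> * t) = dist_nearest_int (of_nat j * \<bar>d\<bar> - u)"
    by (rule dist_nearest_int_cong) (simp add: u_def frac_def)
  also have "\<dots> \<le> \<bar>d\<bar>"
    using dist_nearest_int_le[of "of_nat j * \<bar>d\<bar> - u" 0] close by simp
  finally have "dist_nearest_int (of_nat j * \<theta> - t) \<le> dist_nearest_int \<theta>"
    using d(1) by simp
  moreover have "of_nat j \<le> 1 / dist_nearest_int \<theta>"
  proof -
    have "u / \<bar>d\<bar> \<le> 1 / \<bar>d\<bar>"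
      using u d(2) by (intro divide_right_mono) auto
    then show ?thesis
      using j_le d(1) by simp
  qed
  ultimately show ?thesis
    by blast
qed

text \<open>
  Dirichlet's theorem provides a multiple \<open>Q \<theta>\<close> that serves as a stride below \<open>1/N\<close>. The time needed
  is left in terms of \<open>\<parallel>Q \<theta>\<parallel>\<close>: for an arbitrary irrational \<open>\<theta>\<close> it is merely finite, while a
  Diophantine lower bound on \<open>\<parallel>Q \<theta>\<parallel>\<close> makes it polynomial in \<open>N\<close>.
\<close>

lemma rotation_orbit_dense:
  assumes "\<theta> \<notin> \<rat>" "N > 0"
  shows "\<exists>Q\<in>{1..N}. \<forall>t. \<exists>k::nat. of_nat k \<le> of_nat Q / dist_nearest_int (of_nat Q * \<theta>) \<and>
           dist_nearest_int (of_nat k * \<theta> - t) \<le> 1 / of_nat N"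
proof -
  obtain h Q' where Q': "0 < Q'" "Q' \<le> int N" "\<bar>of_int Q' * \<theta> - of_int h\<bar> < 1 / N"
    using Dirichlet_approx[OF assms(2)] by metis
  define Q where "Q = nat Q'"
  have Q: "Q \<in> {1..N}" "\<bar>of_nat Q * \<theta> - of_int h\<bar> < 1 / N"
    using Q' by (auto simp: Q_def)
  have small: "dist_nearest_int (of_nat Q * \<theta>) \<le> 1 / N"
    using dist_nearest_int_le[of "of_nat Q * \<theta>" h] Q(2) by linarith
  have pos: "0 < dist_nearest_int (of_nat Q * \<theta>)"
    using dist_nearest_int_pos_of_nat_mult[OF assms(1)] Q(1) by simp
  show ?thesis
  proof (intro bexI[OF _ Q(1)] allI)
    fix t
    obtain j where j: "of_nat j \<le> 1 / dist_nearest_int (of_nat Q * \<theta>)"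
      "dist_nearest_int (of_nat j * (of_nat Q * \<theta>) - t) \<le> dist_nearest_int (of_nat Q * \<theta>)"
      using multiples_dense[OF pos] by blast
    have "of_nat (j * Q) \<le> of_nat Q / dist_nearest_int (of_nat Q * \<theta>)"
      using mult_left_mono[OF j(1), of "of_nat Q"] by (simp add: mult.commute)
    moreover have "dist_nearest_int (of_nat (j * Q) * \<theta> - t) \<le> 1 / N"
      using j(2) small by (simp add: mult.assoc)
    ultimately show "\<exists>k::nat. of_nat k \<le> of_nat Q / dist_nearest_int (of_nat Q * \<theta>) \<and>
           dist_nearest_int (of_nat k * \<theta> - t) \<le> 1 / of_nat N"
      by blast
  qed
qed

section \<open>Diophantine meaning of the exact order\<close>

text \<open>
  A finite exact order leaves, for a large enough exponent, only finitely many exceptional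
  denominators; the constant \<open>c\<close> absorbs these.
\<close>

lemma not_liouville_number_lower_bound:
  assumes "\<alpha> \<notin> \<rat>" "\<not> liouville_number \<alpha>"
  shows "\<exists>c>0. \<exists>s::nat. \<forall>k\<ge>1. c / of_nat k ^ s \<le> dist_nearest_int (of_nat k * \<alpha>)"
proof -
  have "exact_order \<alpha> \<noteq> \<infinity>"
    using assms by (simp add: liouville_number_def)
  then obtain n :: nat where n: "exact_order \<alpha> < ereal (real n)"
    using less_PInf_Ex_of_nat by blast
  define s where "s = max n 2"
  have "\<alpha> \<notin> W (real s)"
  proof
    assume "\<alpha> \<in> W (real s)"
    then have "ereal (real s) \<le> exact_order \<alpha>"
      unfolding exact_order_def by (intro Sup_upper) (auto simp: s_def)
    then have "ereal (real s) < ereal (real n)"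
      using n by (rule le_less_trans)
    then show False
      by (simp add: s_def)
  qed
  define S where "S = {(p :: int, q :: nat). q \<ge> 1 \<and> \<bar>\<alpha> - of_int p / of_nat q\<bar> < 1 / (of_nat q powr s)}"
  have fin: "finite S"
    using \<open>\<alpha> \<notin> W (real s)\<close> assms(1) by (auto simp: W_def S_def)
  define V where "V = insert 1 ((\<lambda>q. dist_nearest_int (of_nat q * \<alpha>)) ` snd ` S)"
  define c where "c = Min V"
  have finV: "finite V" "V \<noteq> {}"
    using fin by (auto simp: V_def)
  have "\<forall>v\<in>V. 0 < v"
    using dist_nearest_int_pos_of_nat_mult[OF assms(1)] by (auto simp: V_def S_def)
  then have "c > 0"
    using finV by (simp add: c_def)
  have "c \<le> 1"
    using finV by (auto simp: c_def V_def)
  have "c / of_nat k ^ s \<le> dist_nearest_int (of_nat k * \<alpha>)" if k: "k \<ge> 1" for k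
  proof (cases "k \<in> snd ` S")
    case True
    then have "c \<le> dist_nearest_int (of_nat k * \<alpha>)"
      using finV by (auto simp: c_def V_def intro!: Min_le)
    moreover have "c / of_nat k ^ s \<le> c"
      using \<open>c > 0\<close> k by (simp add: field_simps)
    ultimately show ?thesis
      by linarith
  next
    case False
    define p where "p = round (of_nat k * \<alpha>)"
    have "(p, k) \<notin> S"
      using False by force
    then have "1 / of_nat k ^ s \<le> \<bar>\<alpha> - of_int p / of_nat k\<bar>"
      using k by (simp add: S_def powr_realpow not_less)
    also have "\<dots> \<le> of_nat k * \<bar>\<alpha> - of_int p / of_nat k\<bar>"
      using k by (simp add: mult_le_cancel_right1)
    also have "\<dots> = \<bar>of_nat k * (\<alpha> - of_int p / of_nat k)\<bar>"
      by (simp add: abs_mult)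
    also have "of_nat k * (\<alpha> - of_int p / of_nat k) = of_nat k * \<alpha> - of_int p"
      using k by (simp add: field_simps)
    also have "\<bar>of_nat k * \<alpha> - of_int p\<bar> = dist_nearest_int (of_nat k * \<alpha>)"
      by (simp add: dist_nearest_int_def p_def)
    finally have "1 / of_nat k ^ s \<le> dist_nearest_int (of_nat k * \<alpha>)" .
    moreover have "c / of_nat k ^ s \<le> 1 / of_nat k ^ s"
      using \<open>c \<le> 1\<close> by (intro divide_right_mono) auto
    ultimately show ?thesis
      by linarith
  qed
  then show ?thesis
    using \<open>c > 0\<close> by blast
qed

text \<open>
  The definition supplies infinitely many pairs \<open>(p, q)\<close>. Unboundedness of \<open>q\<close> follows because
  \<open>p\<close> is confined to a bounded range once \<open>q\<close> is.
\<close>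

lemma liouville_number_approx:
  assumes "liouville_number \<beta>"
  shows "\<exists>q::nat. real q \<ge> R \<and> q \<ge> 1 \<and> dist_nearest_int (of_nat q * \<beta>) \<le> 1 / of_nat q ^ M"
proof -
  \<comment> \<open>One power of \<open>q\<close> is lost in passing from \<open>\<beta> - p/q\<close> to \<open>q \<beta> - p\<close>.\<close>
  have "ereal (real (M + 2)) < Sup (ereal ` {\<tau>. \<tau> \<ge> 2 \<and> \<beta> \<in> W \<tau>})"
    using assms by (simp add: liouville_number_def exact_order_def)
  then obtain \<tau> where \<tau>: "real (M + 2) < \<tau>" "\<beta> \<in> W \<tau>"
    by (auto simp: less_Sup_iff)
  define S where "S = {(p :: int, q :: nat). q \<ge> 1 \<and> \<bar>\<beta> - of_int p / of_nat q\<bar> < 1 / (of_nat q powr \<tau>)}"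
  have inf: "infinite S"
    using \<tau>(2) by (auto simp: W_def S_def)
  have close: "\<bar>of_nat q * \<beta> - of_int p\<bar> \<le> 1 / of_nat q ^ M" if "(p, q) \<in> S" for p q
  proof -
    have q: "q \<ge> 1" and less: "\<bar>\<beta> - of_int p / of_nat q\<bar> < 1 / (of_nat q powr \<tau>)"
      using that by (auto simp: S_def)
    have "of_nat q ^ Suc M = of_nat q powr real (Suc M)"
      using q powr_realpow[of "real q" "Suc M"] by simp
    also have "\<dots> \<le> of_nat q powr \<tau>"
      using q \<tau>(1) by (intro powr_mono) auto
    finally have "1 / of_nat q powr \<tau> \<le> 1 / of_nat q ^ Suc M"
      using q by (intro divide_left_mono) auto
    then have "\<bar>\<beta> - of_int p / of_nat q\<bar> \<le> 1 / of_nat q ^ Suc M"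
      using less by linarith
    then have "of_nat q * \<bar>\<beta> - of_int p / of_nat q\<bar> \<le> of_nat q * (1 / of_nat q ^ Suc M)"
      by (intro mult_left_mono) auto
    moreover have "of_nat q * \<bar>\<beta> - of_int p / of_nat q\<bar> = \<bar>of_nat q * (\<beta> - of_int p / of_nat q)\<bar>"
      by (simp add: abs_mult)
    moreover have "of_nat q * (\<beta> - of_int p / of_nat q) = of_nat q * \<beta> - of_int p"
      using q by (simp add: field_simps)
    ultimately show ?thesis
      using q by simp
  qed
  define B where "B = nat \<lceil>R\<rceil>"
  have "\<exists>(p, q)\<in>S. q \<ge> B"
  proof (rule ccontr)
    assume "\<not> (\<exists>(p, q)\<in>S. q \<ge> B)"
    then have bounded: "q < B" if "(p, q) \<in> S" for p q
      using that by (metis (no_types, lifting) case_prodI not_le)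
    define K where "K = \<lceil>real B * \<bar>\<beta>\<bar> + 1\<rceil>"
    have "S \<subseteq> {-K..K} \<times> {..<B}"
    proof (rule subrelI)
      fix p q assume pq: "(p, q) \<in> S"
      have "of_nat q ^ M \<ge> (1::real)"
        using pq by (auto simp: S_def)
      then have "(1::real) / of_nat q ^ M \<le> 1"
        by (subst divide_le_eq_1_pos) linarith+
      then have "\<bar>of_nat q * \<beta> - of_int p\<bar> \<le> 1"
        using close[OF pq] by linarith
      moreover have "\<bar>of_nat q * \<beta>\<bar> \<le> real B * \<bar>\<beta>\<bar>"
        using bounded[OF pq] by (simp add: abs_mult mult_right_mono)
      ultimately have "\<bar>of_int p\<bar> \<le> real B * \<bar>\<beta>\<bar> + 1"
        by linarith
      then have "\<bar>p\<bar> \<le> K"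
        unfolding K_def by linarith
      then show "(p, q) \<in> {-K..K} \<times> {..<B}"
        using bounded[OF pq] by auto
    qed
    then show False
      using inf finite_subset by blast
  qed
  then obtain p q where pq: "(p, q) \<in> S" "q \<ge> B"
    by auto
  have "real q \<ge> R"
    using pq(2) unfolding B_def by linarith
  moreover have "q \<ge> 1"
    using pq(1) by (auto simp: S_def)
  moreover have "dist_nearest_int (of_nat q * \<beta>) \<le> 1 / of_nat q ^ M"
    using dist_nearest_int_le[of "of_nat q * \<beta>" p] close[OF pq(1)] by linarith
  ultimately show ?thesis
    by blast
qed

section \<open>Covering numbers of subsets of the circle\<close>

lemma covering_number_le:
  assumes "finite C" "F \<subseteq> (\<Union>c\<in>C. cball c r)"
  shows "covering_number F r \<le> card C"
  unfolding covering_number_def using assms by (intro Least_le) blast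

lemma covering_number_attained:
  fixes F :: "circle set"
  assumes "r > 0"
  shows "\<exists>C. finite C \<and> card C = covering_number F r \<and> F \<subseteq> (\<Union>c\<in>C. cball c r)"
proof -
  have "\<exists>n. \<exists>C. finite C \<and> card C = n \<and> F \<subseteq> (\<Union>c\<in>C. cball c r)"
    using circle_finite_cover[OF assms] by blast
  then show ?thesis
    unfolding covering_number_def by (rule LeastI_ex)
qed

lemma dist_circle_of: "dist (circle_of a) (circle_of b) = dist_nearest_int (a - b)"
  by (simp add: dist_circle.abs_eq)

lemma circle_of_rep_circle: "circle_of (rep_circle z) = z"
  by (metis Quotient_abs_rep[OF Quotient_circle])

lemma covering_number_circle_le:
  fixes F :: "circle set"
  assumes "m > 0" "1 / real m \<le> r"
  shows "covering_number F r \<le> m"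
proof -
  define C where "C = (\<lambda>j. circle_of (real j / real m)) ` {..<m}"
  have "F \<subseteq> (\<Union>c\<in>C. cball c r)"
  proof
    fix z assume "z \<in> F"
    define u where "u = frac (rep_circle z)"
    have z: "z = circle_of u"
      using circle_of_rep_circle[of z] unfolding u_def
      by (metis circle.abs_eq_iff frac_def diff_diff_eq2 Ints_of_int add_diff_cancel_left')
    define j where "j = nat \<lfloor>u * real m\<rfloor>"
    have u: "0 \<le> u" "u < 1"
      by (auto simp: u_def frac_lt_1)
    have j: "real j \<le> u * real m" "u * real m < real j + 1"
      using u unfolding j_def by (simp_all add: of_nat_nat)
    have "u * real m < real m"
      using u assms(1) by simp
    then have "j < m"
      using j(1) by linarith
    have "dist (circle_of (real j / real m)) z \<le> \<bar>real j / real m - u\<bar>"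
      using dist_nearest_int_le[of "real j / real m - u" 0] by (simp add: z dist_circle_of)
    also have "\<dots> \<le> 1 / real m"
    proof -
      have "real j / real m \<le> u" "u \<le> (real j + 1) / real m"
        using j assms(1) by (simp_all add: divide_le_eq le_divide_eq)
      then show ?thesis
        by (simp add: add_divide_distrib abs_le_iff)
    qed
    finally show "z \<in> (\<Union>c\<in>C. cball c r)"
      using \<open>j < m\<close> assms(2) by (force simp: C_def)
  qed
  then have "covering_number F r \<le> card C"
    by (intro covering_number_le) (auto simp: C_def)
  also have "\<dots> \<le> m"
    using card_image_le[of "{..<m}" "\<lambda>j. circle_of (real j / real m)"] by (simp add: C_def)
  finally show ?thesis .
qed

text \<open>
  The image of \<open>F\<close> under multiplication by \<open>q\<close> is \<open>\<delta>\<close>-dense in the circle. The condition is phrased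
  with real representatives \<open>s\<close>, \<open>t\<close> so that multiplication by \<open>q\<close> and approximation
  can be computed in \<open>\<real>\<close>.
\<close>

definition dilate_dense :: "nat \<Rightarrow> real \<Rightarrow> circle set \<Rightarrow> bool" where
  "dilate_dense q \<delta> F \<longleftrightarrow> (\<forall>t. \<exists>s. circle_of s \<in> F \<and> dist_nearest_int (of_nat q * s - t) \<le> \<delta>)"

text \<open>
  Choose points of \<open>F\<close> whose multiples by \<open>q\<close> approximate \<open>j/m\<close> for \<open>j < m\<close>. Multiplication by \<open>q\<close>
  expands distances at most by the factor \<open>q\<close>, so two points in one ball of radius \<open>1/(5mq)\<close> have
  images within \<open>2/(5m)\<close>; with the two approximation errors this stays below \<open>1/m\<close>, the least
  distance between different targets. Hence each ball contains at most one of the chosen points.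
\<close>

lemma covering_number_ge_of_dilate_dense:
  assumes "dilate_dense q (1 / (4 * real m)) F" "m \<ge> 1" "q \<ge> 1"
  shows "m \<le> covering_number F (1 / (5 * real m * real q))"
proof -
  define r where "r = 1 / (5 * real m * real q)"
  have "r > 0"
    using assms by (simp add: r_def)
  then obtain C where C: "finite C" "card C = covering_number F r" "F \<subseteq> (\<Union>c\<in>C. cball c r)"
    using covering_number_attained by blast
  have "\<forall>j. \<exists>s. circle_of s \<in> F \<and> dist_nearest_int (of_nat q * s - real j / real m) \<le> 1 / (4 * real m)"
    using assms(1) by (auto simp: dilate_dense_def)
  then obtain s where s: "circle_of (s j) \<in> F"
    "dist_nearest_int (of_nat q * s j - real j / real m) \<le> 1 / (4 * real m)" for j :: nat
    by metis
  have "\<forall>j. \<exists>c\<in>C. dist c (circle_of (s j)) \<le> r"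
    using C(3) s(1) by (fastforce simp: subset_iff)
  then obtain c where c: "c j \<in> C" "dist (c j) (circle_of (s j)) \<le> r" for j
    by metis
  have "inj_on c {..<m}"
  proof (rule inj_onI)
    fix i j assume ij: "i \<in> {..<m}" "j \<in> {..<m}" "c i = c j"
    have "dist_nearest_int (s i - s j) \<le> 2 * r"
      using c(2)[of i] c(2)[of j] dist_triangle3[of "circle_of (s i)" "circle_of (s j)" "c i"] ij(3)
      by (simp add: dist_circle_of)
    then have "dist_nearest_int (of_nat q * (s i - s j)) \<le> of_nat q * (2 * r)"
      using dist_nearest_int_of_nat_mult[of q "s i - s j"]
      by (meson mult_left_mono of_nat_0_le_iff order_trans)
    also have "\<dots> = 2 / (5 * real m)"
      using assms by (simp add: r_def field_simps)
    finally have close: "dist_nearest_int (of_nat q * (s i - s j)) \<le> 2 / (5 * real m)" .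
    define d where "d = (real i - real j) / real m"
    have "dist_nearest_int d \<le> dist_nearest_int (of_nat q * (s i - s j)) +
        dist_nearest_int (of_nat q * s j - real j / real m) +
        dist_nearest_int (real i / real m - of_nat q * s i)"
      using dist_nearest_int_add[of "of_nat q * (s i - s j)" "of_nat q * s j - real j / real m"]
        dist_nearest_int_add[of "of_nat q * (s i - s j) + (of_nat q * s j - real j / real m)"
          "real i / real m - of_nat q * s i"]
      by (simp add: d_def algebra_simps diff_divide_distrib)
    also have "\<dots> \<le> 2 / (5 * real m) + 1 / (4 * real m) + 1 / (4 * real m)"
      using s(2)[of i] s(2)[of j] close by (simp add: dist_nearest_int_minus[of "real i / real m"])
    also have "\<dots> < 1 / real m"
      using assms(2) by (simp add: field_simps)
    finally have "\<bar>d - of_int (round d)\<bar> * real m < 1"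
      using assms(2) by (simp add: dist_nearest_int_def field_simps)
    moreover have "\<bar>d - of_int (round d)\<bar> * real m = \<bar>(d - of_int (round d)) * real m\<bar>"
      by (simp add: abs_mult)
    moreover have "(d - of_int (round d)) * real m = of_int (int i - int j - round d * int m)"
      using assms(2) by (simp add: d_def field_simps)
    ultimately have "\<bar>real_of_int (int i - int j - round d * int m)\<bar> < 1"
      by simp
    then have "int i - int j = round d * int m"
      by linarith
    moreover have "\<bar>int i - int j\<bar> < int m"
      using ij by auto
    ultimately have "int i - int j = 0"
      by (metis dvd_imp_le_int dvd_triv_right not_le abs_of_nat)
    then show "i = j"
      by simp
  qed
  then have "card {..<m} \<le> card C"
    using c(1) C(1) by (intro card_inj_on_le[of c]) auto
  then show ?thesis
    using C(2) by (simp add: r_def)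
qed

lemma upper_box_dim_circle_le:
  fixes F :: "circle set"
  shows "upper_box_dim F \<le> 1"
proof -
  have "\<forall>\<^sub>F r in at_right 0. ln (real (covering_number F r)) / - ln r \<le> 1 + ln 2 / - ln r"
    unfolding eventually_at_right_field
  proof (intro exI[of _ 1] conjI allI impI)
    fix r :: real assume r: "0 < r" "r < 1"
    define m where "m = nat \<lceil>1 / r\<rceil>"
    have m: "1 / r \<le> real m" "real m < 1 / r + 1"
      using r unfolding m_def by (simp_all add: of_nat_nat ceiling_correct) linarith
    have "real m > 0"
      using m(1) r by (metis divide_pos_pos less_le_trans zero_less_one)
    then have "covering_number F r \<le> m"
      using m(1) r by (intro covering_number_circle_le) (auto simp: field_simps)
    then have "real (covering_number F r) \<le> real m"
      by simp
    also have "\<dots> \<le> 2 / r"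
      using m(2) r by (simp add: field_simps)
    finally have N: "real (covering_number F r) \<le> 2 / r" .
    have "ln (real (covering_number F r)) \<le> ln 2 - ln r"
    proof (cases "covering_number F r = 0")
      case True
      then show ?thesis
        using r ln_ge_zero[of 2] by (simp add: ln_le_zero_iff add_increasing)
    next
      case False
      then have "ln (real (covering_number F r)) \<le> ln (2 / r)"
        using N r by (subst ln_le_cancel_iff) auto
      then show ?thesis
        using r by (simp add: ln_div)
    qed
    then show "ln (real (covering_number F r)) / - ln r \<le> 1 + ln 2 / - ln r"
      using r by (simp add: field_simps)
  qed simp
  then have "upper_box_dim F \<le> Limsup (at_right 0) (\<lambda>r. ereal (1 + ln 2 / - ln r))"
    unfolding upper_box_dim_def by (intro Limsup_mono) simp
  also have "\<dots> = 1"
  proof (rule lim_imp_Limsup)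
    have "((\<lambda>r::real. 1 + ln 2 / - ln r) \<longlongrightarrow> 1 + 0) (at_right 0)"
      by (intro tendsto_intros tendsto_divide_0[OF tendsto_const]
          filterlim_at_top_imp_at_infinity filterlim_uminus_at_bot[THEN iffD1] ln_at_0)
    then show "((\<lambda>r. ereal (1 + ln 2 / - ln r)) \<longlongrightarrow> 1) (at_right 0)"
      by (simp add: one_ereal_def)
  qed simp
  finally show ?thesis .
qed

text \<open>
  At the radius \<open>r = 1/(5mq)\<close> one has \<open>- ln r = ln m + ln q + ln 5\<close>. If \<open>m\<close> is at least \<open>q ^ L\<close> and
  \<open>5 ^ L\<close>, the last two terms are at most \<open>ln m / L\<close> each, so the ratio of logarithms is at least
  \<open>L / (L + 2)\<close>.
\<close>

lemma upper_box_dim_ge_of_dilate_dense: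
  fixes F :: "circle set"
  assumes "\<And>L R. \<exists>m q :: nat. real m \<ge> R \<and> q \<ge> 1 \<and> q ^ L \<le> m \<and> dilate_dense q (1 / (4 * real m)) F"
  shows "1 \<le> upper_box_dim F"
proof (rule ccontr)
  assume "\<not> 1 \<le> upper_box_dim F"
  then have "upper_box_dim F < 1"
    by simp
  then obtain s :: real where s: "upper_box_dim F < ereal s" "s < 1"
    using ereal_dense2[of "upper_box_dim F" 1] by auto
  obtain b where b: "b > 0"
    "\<And>r. 0 < r \<Longrightarrow> r < b \<Longrightarrow> ln (real (covering_number F r)) / - ln r < s"
    using Limsup_lessD[OF s(1)[unfolded upper_box_dim_def]]
    by (auto simp: eventually_at_right_field)
  \<comment> \<open>Chosen so that \<open>s \<le> L / (L + 2)\<close>.\<close>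
  define L where "L = nat \<lceil>2 / (1 - s)\<rceil>"
  have "2 / (1 - s) \<le> real L"
    unfolding L_def by linarith
  then have "2 \<le> real L * (1 - s)"
    using s(2) by (simp add: field_simps)
  then have L: "s * (real L + 2) \<le> real L"
    using s(2) by (simp add: algebra_simps)
  obtain m q :: nat where mq: "real m \<ge> max (5 ^ L) (1 / b)" "q \<ge> 1" "q ^ L \<le> m"
    "dilate_dense q (1 / (4 * real m)) F"
    using assms by metis
  have m5: "5 ^ L \<le> real m" and mb: "1 / b \<le> real m"
    using mq(1) by auto
  have m: "m \<ge> 1"
    using mb b(1) by (metis One_nat_def Suc_leI divide_pos_pos less_le_trans of_nat_0_less_iff zero_less_one)
  define r where "r = 1 / (5 * real m * real q)"
  have r: "r > 0"
    using m mq(2) by (simp add: r_def)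
  have "real m * 1 < 5 * real m * real q"
    using m mq(2) by (simp add: less_le_trans[of _ 5])
  then have "1 < b * (5 * real m * real q)"
    using mb b(1) by (simp add: field_simps) (smt (verit) mult_strict_left_mono)
  then have "r < b"
    using m mq(2) by (simp add: r_def field_simps)
  have lnr: "- ln r = ln 5 + ln (real m) + ln (real q)"
    using m mq(2) by (simp add: r_def ln_div ln_mult)
  have neg: "- ln r > 0"
    unfolding lnr using m mq(2) by (simp add: add_pos_nonneg)
  have "real L * ln 5 = ln (5 ^ L)"
    by (simp add: ln_realpow)
  also have "\<dots> \<le> ln (real m)"
    using m5 m by (subst ln_le_cancel_iff) auto
  finally have 1: "real L * ln 5 \<le> ln (real m)" .
  have "real L * ln (real q) = ln (real q ^ L)"
    using mq(2) by (simp add: ln_realpow)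
  also have "\<dots> \<le> ln (real m)"
    using mq m by (subst ln_le_cancel_iff) (auto simp flip: of_nat_power)
  finally have 2: "real L * ln (real q) \<le> ln (real m)" .
  have "(real L + 2) * (s * - ln r) = s * (real L + 2) * - ln r"
    by simp
  also have "\<dots> \<le> real L * - ln r"
    using L neg by (intro mult_right_mono) auto
  also have "\<dots> \<le> (real L + 2) * ln (real m)"
    using 1 2 unfolding lnr by (simp add: algebra_simps)
  finally have "s * - ln r \<le> ln (real m)"
    by (subst (asm) mult_le_cancel_left_pos) auto
  also have "\<dots> \<le> ln (real (covering_number F r))"
    using covering_number_ge_of_dilate_dense[OF mq(4) m mq(2)] m
    by (subst ln_le_cancel_iff) (auto simp: r_def)
  finally have "s \<le> ln (real (covering_number F r)) / - ln r"
    using neg by (subst pos_le_divide_eq) auto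
  with b(2)[OF r \<open>r < b\<close>] show False
    by simp
qed

section \<open>Density of dilated orbits\<close>

lemma circle_of_add: "circle_of a + circle_of b = circle_of (a + b)"
  by (simp add: plus_circle.abs_eq)

lemma orbit_run:
  assumes "\<forall>i<j. x (Suc (n + i)) - x (n + i) = circle_of \<beta>"
  shows "x (n + j) = x n + circle_of (of_nat j * \<beta>)"
  using assms
proof (induction j)
  case 0
  have "circle_of 0 = 0"
    by (simp add: zero_circle_def)
  then show ?case
    by simp
next
  case (Suc j)
  have "x (n + Suc j) = x (n + j) + circle_of \<beta>"
    using Suc.prems by (metis add_Suc_right diff_add_cancel add.commute lessI)
  also have "\<dots> = x n + circle_of (of_nat (Suc j) * \<beta>)"
    using Suc by (simp add: add.assoc circle_of_add algebra_simps)
  finally show ?case .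
qed

lemma dilate_dense_of_long_runs:
  assumes "\<beta> \<notin> \<rat>" "m \<ge> 1"
    and runs: "\<And>H. \<exists>n. \<forall>j<H. x (Suc (n + j)) - x (n + j) = circle_of \<beta>"
  shows "dilate_dense 1 (1 / (4 * real m)) (range x)"
  unfolding dilate_dense_def
proof
  fix t
  obtain Q where "Q \<in> {1..4 * m}" and
    Q: "\<And>t. \<exists>k::nat. of_nat k \<le> of_nat Q / dist_nearest_int (of_nat Q * \<beta>) \<and>
           dist_nearest_int (of_nat k * \<beta> - t) \<le> 1 / of_nat (4 * m)"
    using rotation_orbit_dense[OF assms(1), of "4 * m"] assms(2) by auto
  define H where "H = nat \<lfloor>of_nat Q / dist_nearest_int (of_nat Q * \<beta>)\<rfloor>"
  obtain n where n: "\<forall>j<H. x (Suc (n + j)) - x (n + j) = circle_of \<beta>"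
    using runs by blast
  define y where "y = rep_circle (x n)"
  obtain k :: nat where k: "of_nat k \<le> of_nat Q / dist_nearest_int (of_nat Q * \<beta>)"
    "dist_nearest_int (of_nat k * \<beta> - (t - y)) \<le> 1 / of_nat (4 * m)"
    using Q by blast
  have "k \<le> H"
    using k(1) unfolding H_def by (metis le_nat_floor)
  then have "x (n + k) = circle_of (y + of_nat k * \<beta>)"
    using n orbit_run[of k x n \<beta>] by (simp add: y_def circle_of_rep_circle flip: circle_of_add)
  then have "circle_of (y + of_nat k * \<beta>) \<in> range x"
    by (metis rangeI)
  moreover have "dist_nearest_int (of_nat 1 * (y + of_nat k * \<beta>) - t) \<le> 1 / (4 * real m)"
    using k(2) by (simp add: algebra_simps)
  ultimately show "\<exists>s. circle_of s \<in> range x \<and> dist_nearest_int (of_nat 1 * s - t) \<le> 1 / (4 * real m)"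
    by blast
qed

text \<open>
  The orbit is followed from one \<open>\<alpha>\<close> step to the next; each takes at most \<open>H\<close> steps to arrive, so
  every count \<open>k\<close> is attained by time \<open>k H\<close>. The number \<open>b\<close> of \<open>\<beta>\<close> steps made meanwhile is not under control
  beyond \<open>b \<le> n\<close>.
\<close>

lemma orbit_time_of_alpha_steps:
  assumes "alpha_beta_orbit \<alpha> \<beta> x"
    and window: "\<And>n. \<exists>j<H. x (Suc (n + j)) - x (n + j) = circle_of \<alpha>"
  shows "\<exists>n\<le>k * H. \<exists>b\<le>n. x n = x 0 + circle_of (of_nat k * \<alpha> + of_nat b * \<beta>)"
proof (induction k)
  case 0
  have "circle_of 0 = 0"
    by (simp add: zero_circle_def)
  then show ?case
    by simp
next
  case (Suc k)
  then obtain n b where n: "n \<le> k * H" "b \<le> n"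
    "x n = x 0 + circle_of (of_nat k * \<alpha> + of_nat b * \<beta>)"
    by blast
  define P where "P = (\<lambda>j. x (Suc (n + j)) - x (n + j) = circle_of \<alpha>)"
  obtain j where j: "j < H" "P j" "\<forall>i<j. \<not> P i"
  proof -
    obtain j' where j': "j' < H" "P j'"
      using window[of n] by (auto simp: P_def)
    show thesis
    proof (rule that[of "LEAST j. P j"])
      show "(LEAST j. P j) < H"
        using j' by (meson Least_le le_less_trans)
      show "P (LEAST j. P j)"
        using j'(2) by (rule LeastI)
      show "\<forall>i<LEAST j. P j. \<not> P i"
        using not_less_Least by blast
    qed
  qed
  have "\<forall>i<j. x (Suc (n + i)) - x (n + i) = circle_of \<beta>"
    using j(3) assms(1) unfolding P_def alpha_beta_orbit_def by blast
  then have "x (n + j) = x n + circle_of (of_nat j * \<beta>)"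
    by (rule orbit_run)
  moreover have "x (Suc (n + j)) = x (n + j) + circle_of \<alpha>"
    using j(2) unfolding P_def by (metis diff_add_cancel add.commute)
  ultimately have "x (Suc (n + j)) = x 0 + circle_of (of_nat (Suc k) * \<alpha> + of_nat (b + j) * \<beta>)"
    by (simp add: n(3) add.assoc circle_of_add algebra_simps)
  moreover have "Suc (n + j) \<le> Suc k * H"
    using n(1) j(1) by simp
  moreover have "b + j \<le> Suc (n + j)"
    using n(2) by simp
  ultimately show ?case
    by blast
qed

text \<open>
  Up to the time at which the rotation by \<open>q \<alpha>\<close> has become \<open>1/(8m)\<close>-dense, the \<open>\<beta>\<close> steps displace
  \<open>q x\<^sub>n\<close> by at most \<open>1/(8m)\<close> in total. With \<open>m = q ^ L\<close> the time is \<open>A q ^ E\<close>, where \<open>A\<close> is a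
  constant and the exponent \<open>E\<close> comes from the Diophantine exponent \<open>s\<close> of \<open>\<alpha>\<close>; then \<open>\<beta>\<close> is
  approximated to the order \<open>E + L + 1\<close>, the last power of \<open>q\<close> paying for \<open>8 A\<close>.
\<close>

lemma dilate_dense_of_bounded_gaps:
  assumes "\<alpha> \<notin> \<rat>" "\<not> liouville_number \<alpha>" "liouville_number \<beta>"
    and orbit: "alpha_beta_orbit \<alpha> \<beta> x"
    and window: "\<And>n. \<exists>j<H. x (Suc (n + j)) - x (n + j) = circle_of \<alpha>"
  shows "\<exists>q::nat. real q \<ge> R \<and> q \<ge> 1 \<and> dilate_dense q (1 / (4 * real (q ^ L))) (range x)"
proof -
  obtain c s where c: "c > 0"
    "\<And>k. k \<ge> 1 \<Longrightarrow> c / of_nat k ^ s \<le> dist_nearest_int (of_nat k * \<alpha>)"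
    using not_liouville_number_lower_bound[OF assms(1,2)] by blast
  define E where "E = s * (L + 1) + L"
  define A where "A = 8 ^ Suc s * real H / c"
  obtain q :: nat where q: "real q \<ge> max R (8 * A)" "q \<ge> 1"
    "dist_nearest_int (of_nat q * \<beta>) \<le> 1 / of_nat q ^ (E + Suc L)"
    using liouville_number_approx[OF assms(3)] by blast
  define m where "m = q ^ L"
  have m: "m \<ge> 1"
    using q(2) by (simp add: m_def)
  have "of_nat q * \<alpha> \<notin> \<rat>"
    using of_nat_mult_not_Rats[OF assms(1) q(2)] .
  then obtain Q where Q: "Q \<in> {1..8 * m}" and
    dense: "\<And>t. \<exists>k::nat. of_nat k \<le> of_nat Q / dist_nearest_int (of_nat Q * (of_nat q * \<alpha>)) \<and>
           dist_nearest_int (of_nat k * (of_nat q * \<alpha>) - t) \<le> 1 / of_nat (8 * m)"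
    using rotation_orbit_dense[of "of_nat q * \<alpha>" "8 * m"] m by auto
  have time: "real k * real H \<le> A * real q ^ E"
    if k: "of_nat k \<le> of_nat Q / dist_nearest_int (of_nat Q * (of_nat q * \<alpha>))" for k
  proof -
    have pos: "c / real (Q * q) ^ s > 0"
      using c(1) Q q(2) by simp
    have "c / real (Q * q) ^ s \<le> dist_nearest_int (of_nat Q * (of_nat q * \<alpha>))"
      using c(2)[of "Q * q"] Q q(2) by (simp add: mult.assoc)
    then have "real Q / dist_nearest_int (of_nat Q * (of_nat q * \<alpha>)) \<le> real Q / (c / real (Q * q) ^ s)"
      using pos by (intro divide_left_mono mult_pos_pos) auto
    also have "\<dots> = real Q * real (Q * q) ^ s / c"
      by simp
    also have "\<dots> \<le> real (8 * m) * real (8 * m * q) ^ s / c"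
    proof -
      have "Q \<le> 8 * m"
        using Q by simp
      then have "Q * (Q * q) ^ s \<le> 8 * m * (8 * m * q) ^ s"
        by (intro mult_mono power_mono) auto
      then have "real (Q * (Q * q) ^ s) \<le> real (8 * m * (8 * m * q) ^ s)"
        by (rule of_nat_mono)
      then show ?thesis
        using c(1) by (intro divide_right_mono) auto
    qed
    also have "\<dots> = 8 ^ Suc s * real q ^ E / c"
      by (simp add: m_def E_def power_mult_distrib power_add power_mult ac_simps flip: power_mult)
    finally have "real k * real H \<le> 8 ^ Suc s * real q ^ E / c * real H"
      using k by (intro mult_right_mono) auto
    then show ?thesis
      by (simp add: A_def ac_simps)
  qed
  have "dilate_dense q (1 / (4 * real m)) (range x)"
    unfolding dilate_dense_def
  proof
    fix t
    define y where "y = rep_circle (x 0)"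
    obtain k :: nat where k: "of_nat k \<le> of_nat Q / dist_nearest_int (of_nat Q * (of_nat q * \<alpha>))"
      "dist_nearest_int (of_nat k * (of_nat q * \<alpha>) - (t - of_nat q * y)) \<le> 1 / of_nat (8 * m)"
      using dense by blast
    obtain n b where n: "n \<le> k * H" "b \<le> n"
      "x n = x 0 + circle_of (of_nat k * \<alpha> + of_nat b * \<beta>)"
      using orbit_time_of_alpha_steps[OF orbit window] by blast
    define z where "z = y + (of_nat k * \<alpha> + of_nat b * \<beta>)"
    have "x n = circle_of z"
      by (simp add: n(3) z_def y_def circle_of_rep_circle flip: circle_of_add)
    then have "circle_of z \<in> range x"
      by (metis rangeI)
    have "real b \<le> real (k * H)"
      using n by (intro of_nat_mono) simp
    also have "\<dots> \<le> A * real q ^ E"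
      using time[OF k(1)] by simp
    also have "\<dots> \<le> real q / 8 * real q ^ E"
      using q(1) by (intro mult_right_mono) auto
    finally have b: "real b \<le> real q ^ Suc E / 8"
      by simp
    have "dist_nearest_int (of_nat b * (of_nat q * \<beta>)) \<le> of_nat b * dist_nearest_int (of_nat q * \<beta>)"
      by (rule dist_nearest_int_of_nat_mult)
    also have "\<dots> \<le> real q ^ Suc E / 8 * (1 / of_nat q ^ (E + Suc L))"
      using b q(3) by (intro mult_mono) (auto simp: dist_nearest_int_nonneg)
    also have "\<dots> = 1 / (8 * real m)"
      using q(2) by (simp add: m_def power_add)
    finally have drift: "dist_nearest_int (of_nat b * (of_nat q * \<beta>)) \<le> 1 / (8 * real m)" .
    have rot: "dist_nearest_int (of_nat k * (of_nat q * \<alpha>) - (t - of_nat q * y)) \<le> 1 / (8 * real m)"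
      using k(2) by simp
    have split: "of_nat q * z - t =
        of_nat b * (of_nat q * \<beta>) + (of_nat k * (of_nat q * \<alpha>) - (t - of_nat q * y))"
      by (simp add: z_def algebra_simps)
    have "dist_nearest_int (of_nat q * z - t) \<le> 1 / (8 * real m) + 1 / (8 * real m)"
      unfolding split
      using dist_nearest_int_add[of "of_nat b * (of_nat q * \<beta>)"
          "of_nat k * (of_nat q * \<alpha>) - (t - of_nat q * y)"] drift rot
      by linarith
    also have "\<dots> = 1 / (4 * real m)"
      by simp
    finally show "\<exists>s. circle_of s \<in> range x \<and> dist_nearest_int (of_nat q * s - t) \<le> 1 / (4 * real m)"
      using \<open>circle_of z \<in> range x\<close> by blast
  qed
  then show ?thesis
    using q by (auto simp: m_def)
qed

theorem corollary1p2:
  fixes \<alpha> \<beta> :: real and x :: "nat \<Rightarrow> circle"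
  assumes "\<alpha> \<notin> \<rat>" and "\<beta> \<notin> \<rat>"
    and "\<not> liouville_number \<alpha>"
    and "liouville_number \<beta>"
    and "alpha_beta_orbit \<alpha> \<beta> x"
  shows "upper_box_dim (range x) = 1"
proof (rule antisym[OF upper_box_dim_circle_le upper_box_dim_ge_of_dilate_dense])
  fix L :: nat and R :: real
  show "\<exists>m q :: nat. real m \<ge> R \<and> q \<ge> 1 \<and> q ^ L \<le> m \<and> dilate_dense q (1 / (4 * real m)) (range x)"
  proof (cases "\<exists>H. \<forall>n. \<exists>j<H. x (Suc (n + j)) - x (n + j) = circle_of \<alpha>")
    case True
    then obtain H where H: "\<And>n. \<exists>j<H. x (Suc (n + j)) - x (n + j) = circle_of \<alpha>"
      by blast
    \<comment> \<open>The exponent \<open>L + 1\<close> makes \<open>m\<close> at least \<open>q\<close>, hence large, even if \<open>L = 0\<close>.\<close>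
    obtain q :: nat where q: "real q \<ge> R" "q \<ge> 1"
      "dilate_dense q (1 / (4 * real (q ^ Suc L))) (range x)"
      using dilate_dense_of_bounded_gaps[OF assms(1,3-5) H] by blast
    have "q ^ 1 \<le> q ^ Suc L" "q ^ L \<le> q ^ Suc L"
      using q(2) by (intro power_increasing; simp)+
    moreover from this have "real q \<le> real (q ^ Suc L)"
      by (intro of_nat_mono) simp
    ultimately show ?thesis
      using q order_trans by blast
  next
    case False
    then have "\<exists>n. \<forall>j<H. x (Suc (n + j)) - x (n + j) = circle_of \<beta>" for H
      using assms(5) unfolding alpha_beta_orbit_def by blast
    then have dense: "dilate_dense 1 (1 / (4 * real m)) (range x)" if "m \<ge> 1" for m
      using dilate_dense_of_long_runs[OF assms(2) that] by blast
    define m where "m = Suc (nat \<lceil>R\<rceil>)"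
    have "R \<le> real m" "m \<ge> 1"
      unfolding m_def by linarith+
    then show ?thesis
      using dense by (intro exI[of _ m] exI[of _ 1]) auto
  qed
qed

end
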